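(* Let $(\xi_k^x)_{k\ge1}$ and $(\xi_k^y)_{k\ge1}$ be independent sequences of i.i.d. non-negative integer-valued random variables, with associated environment $\Xi$. Assume that for all $\varepsilon\in(0,1-p_c]$ there exists $\delta=\delta(\varepsilon)\in(0,p_c]$ such that $$\mathbb{P}^{\Xi}_{p_c+\varepsilon,\,p_c-\delta}(o\longleftrightarrow\infty)>0\quad\text{for }\mu_\xi\text{-almost every }\Xi.$$ Then, for all $\phi\in(0,1]$ and $\tilde\varepsilon\in(0,1-p_c]$, there exists $\tilde\delta=\tilde\delta(\tilde\varepsilon,\phi)\in(0,p_c]$ such that $$\mathbb{P}^{\Xi_\phi}_{p_c+\tilde\varepsilon,\,p_c-\tilde\delta}(o\longleftrightarrow\infty)>0\quad\text{for }(\mu_\xi\times\nu_\phi)\text{-almost every }\Xi_\phi.$$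
   Context: $\mathbb{Z}_+=\{0,1,2,\dots\}$, and $\mathbb{L}^2_+$ is the nearest-neighbour square lattice restricted to the first quadrant, with vertex set $\mathbb{Z}_+^2$ and origin $o=(0,0)$. Random environment: the spacings define the selected columns $\mathcal{C}=\{0\}\cup\{\sum_{k=1}^m\xi_k^x: m\ge1\}$, the selected rows $\mathcal{R}=\{0\}\cup\{\sum_{k=1}^m\xi_k^y: m\ge1\}$, and the environment $\Xi=\mathcal{C}\times\mathcal{R}\subset\mathbb{Z}_+^2$. $\mu_\xi$ denotes the law of the environment, i.e. the product of the law of $\mathcal{C}$ and the law of $\mathcal{R}$. Diluted environment: for $\phi\in[0,1]$, let $(\mathcal{D}_v)_{v\in\mathbb{Z}_+^2}$ be i.i.d. Bernoulli random variables of parameter $\phi$, with product law $\nu_\phi$, independent of $\Xi$; set $\Xi_\phi=\{v\in\Xi:\mathcal{D}_v=1\}$. Percolation: for a fixed set $A\subset\mathbb{Z}_+^2$ (here $A=\Xi$ or $A=\Xi_\phi$) and $p,q\in[0,1]$, $\mathbb{P}^{A}_{p,q}$ is the product measure on $\{0,1\}^{\mathbb{Z}_+^2}$ under which the $\omega(v)$, $v\in\mathbb{Z}_+^2$, are independent, with $\omega(v)=1$ ($v$ open) with probability $p$ if $v\in A$ and with probability $q$ if $v\notin A$. A path (sequence of distinct successively adjacent vertices) is open if all its vertices are open. $\{o\longleftrightarrow\infty\}$ is the event that there is an unbounded sequence of vertices of $\mathbb{Z}_+^2$ each connected to $o$ by an open path. $p_c$ is the critical threshold of homogeneous Bernoulli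 site percolation on $\mathbb{L}^2_+$. *)

theory Defs
  imports "HOL-Probability.Probability"
begin

type_synonym vertex = "nat \<times> nat"

definition adjacent :: "vertex \<Rightarrow> vertex \<Rightarrow> bool" where
  "adjacent u v \<longleftrightarrow>
     \<bar>int (fst u) - int (fst v)\<bar> + \<bar>int (snd u) - int (snd v)\<bar> = 1"

definition is_path :: "vertex list \<Rightarrow> bool" where
  "is_path vs \<longleftrightarrow> vs \<noteq> [] \<and> distinct vs \<and> successively adjacent vs"

definition open_connected :: "(vertex \<Rightarrow> bool) \<Rightarrow> vertex \<Rightarrow> vertex \<Rightarrow> bool" where
  "open_connected \<omega> u v \<longleftrightarrow>
     (\<exists>vs. is_path vs \<and> hd vs = u \<and> last vs = v \<and> (\<forall>w\<in>set vs. \<omega> w))"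

definition origin_to_infinity :: "(vertex \<Rightarrow> bool) set" where
  "origin_to_infinity =
     {\<omega>. \<exists>s :: nat \<Rightarrow> vertex.
        \<not> bounded (range (\<lambda>n. (real (fst (s n)), real (snd (s n))))) \<and>
        (\<forall>n. open_connected \<omega> (0, 0) (s n))}"

definition bernoulli_field :: "(vertex \<Rightarrow> real) \<Rightarrow> (vertex \<Rightarrow> bool) measure" where
  "bernoulli_field r = PiM UNIV (\<lambda>v. measure_pmf (bernoulli_pmf (r v)))"

definition percolation :: "vertex set \<Rightarrow> real \<Rightarrow> real \<Rightarrow> (vertex \<Rightarrow> bool) measure" where
  "percolation A p q = bernoulli_field (\<lambda>v. if v \<in> A then p else q)"

definition p_c :: real where
  "p_c = Inf {p \<in> {0..1}. measure (bernoulli_field (\<lambda>_. p)) origin_to_infinity > 0}"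

definition iid_spacings :: "'a measure \<Rightarrow> (nat \<Rightarrow> 'a \<Rightarrow> nat) \<Rightarrow> bool" where
  "iid_spacings M \<xi> \<longleftrightarrow>
     prob_space.indep_vars M (\<lambda>_. count_space UNIV) \<xi> {1..} \<and>
     (\<forall>k\<ge>1. distr M (count_space UNIV) (\<xi> k) = distr M (count_space UNIV) (\<xi> 1))"

definition independent_spacings ::
    "'a measure \<Rightarrow> (nat \<Rightarrow> 'a \<Rightarrow> nat) \<Rightarrow> (nat \<Rightarrow> 'a \<Rightarrow> nat) \<Rightarrow> bool" where
  "independent_spacings M \<xi> \<eta> \<longleftrightarrow>
     prob_space.indep_var M
       (PiM {1..} (\<lambda>_. count_space UNIV)) (\<lambda>a. \<lambda>k\<in>{1..}. \<xi> k a)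
       (PiM {1..} (\<lambda>_. count_space UNIV)) (\<lambda>a. \<lambda>k\<in>{1..}. \<eta> k a)"

definition selected_lines :: "(nat \<Rightarrow> 'a \<Rightarrow> nat) \<Rightarrow> 'a \<Rightarrow> nat set" where
  "selected_lines \<xi> a = {0} \<union> {\<Sum>k=1..m. \<xi> k a | m. m \<ge> 1}"

text \<open>Random subsets of \<open>nat\<close> are measured on the product sigma-algebra of \<open>{0,1}\<close>-valued
  indicator sequences, i.e. the one generated by the cylinders \<open>{S. n \<in> S}\<close>.\<close>

definition nat_set_space :: "nat set measure" where
  "nat_set_space = sigma UNIV (range (\<lambda>n. {S. n \<in> S}))"

definition lines_law :: "'a measure \<Rightarrow> (nat \<Rightarrow> 'a \<Rightarrow> nat) \<Rightarrow> nat set measure" where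
  "lines_law M \<xi> = distr M nat_set_space (selected_lines \<xi>)"

text \<open>An environment \<open>C \<times> R\<close> is represented by the pair \<open>(C, R)\<close>; nothing is lost, since
  \<open>C\<close> and \<open>R\<close> both contain \<open>0\<close> and are therefore determined by \<open>C \<times> R\<close>.\<close>

definition environment_law ::
    "'a measure \<Rightarrow> (nat \<Rightarrow> 'a \<Rightarrow> nat) \<Rightarrow> (nat \<Rightarrow> 'a \<Rightarrow> nat) \<Rightarrow> (nat set \<times> nat set) measure" where
  "environment_law M \<xi> \<eta> = lines_law M \<xi> \<Otimes>\<^sub>M lines_law M \<eta>"

definition dilution_law :: "real \<Rightarrow> (vertex \<Rightarrow> bool) measure" where
  "dilution_law \<phi> = bernoulli_field (\<lambda>_. \<phi>)"

definition diluted :: "vertex set \<Rightarrow> (vertex \<Rightarrow> bool) \<Rightarrow> vertex set" where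
  "diluted A D = {v \<in> A. D v}"

end

theory Submission
  imports Defs
begin

text \<open>Averaging over the dilution turns the diluted environment into an undiluted one with a smaller
  boost: a vertex of \<open>\<Xi>\<close> is open with probability \<open>p_c + \<epsilon>'\<close> if it is kept and \<open>p_c - \<delta>'\<close> if it is
  removed, hence with probability \<open>\<phi> (p_c + \<epsilon>') + (1 - \<phi>) (p_c - \<delta>')\<close> overall, independently of all other
  vertices. This mean is at least \<open>p_c + \<phi> \<epsilon>' / 2\<close> once \<open>\<delta>' \<le> \<phi> \<epsilon>' / 2\<close>. The hypothesis at
  \<open>\<epsilon> = \<phi> \<epsilon>' / 2\<close>, with its \<open>\<delta>\<close>, together with monotonicity in the parameters
  (\<open>bernoulli_field_mono\<close>), then shows that for almost every \<open>\<Xi>\<close> and every \<open>\<delta>' \<le> min \<delta> \<epsilon>\<close> the averaged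
  process percolates with positive probability. The averaging identity is
  \<open>emeasure_bernoulli_field_mixture\<close>; it implies that the set of dilutions under which the quenched
  process percolates with positive probability is not a null set.

  It remains to pass from positive probability to almost sure. Changing the dilution at finitely
  many vertices changes finitely many opening probabilities, and as long as \<open>p_c - \<delta>' > 0\<close> this cannot
  destroy positivity for an increasing event: with positive probability all these vertices are open
  anyway (\<open>emeasure_bernoulli_field_pos_finite_change\<close>). So the set of good dilutions is a tail event
  of an independent field and has probability \<open>0\<close> or \<open>1\<close> (\<open>bernoulli_field_0_1_law\<close>). These steps make up
  \<open>AE_diluted_percolation_pos\<close>. Taking \<open>\<delta>' < p_c\<close> is possible because the hypothesis provides
  some \<open>\<delta> \<in> {0<..p_c}\<close> and thus forces \<open>p_c > 0\<close>.

  Passing from almost every environment and, given it, almost every dilution to almost every pair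
  is Fubini, for which the percolation probability must be a jointly measurable function of the
  environment and the dilution (\<open>measurable_bernoulli_field\<close>).\<close>

section \<open>Bernoulli fields\<close>

abbreviation config_space :: "(vertex \<Rightarrow> bool) measure" where
  "config_space \<equiv> PiM UNIV (\<lambda>_. count_space UNIV)"

abbreviation unit_uniform :: "real measure" where
  "unit_uniform \<equiv> uniform_measure lborel {0..1}"

abbreviation uniform_field :: "(vertex \<Rightarrow> real) measure" where
  "uniform_field \<equiv> PiM UNIV (\<lambda>_. unit_uniform)"

lemma space_config_space [simp]: "space config_space = UNIV"
  by (auto simp: space_PiM)

lemma sets_bernoulli_field [simp, measurable_cong]: "sets (bernoulli_field r) = sets config_space"
  unfolding bernoulli_field_def by (intro sets_PiM_cong) auto

lemma space_bernoulli_field [simp]: "space (bernoulli_field r) = UNIV"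
  using sets_eq_imp_space_eq[OF sets_bernoulli_field] by simp

lemma prob_space_bernoulli_field: "prob_space (bernoulli_field r)"
  unfolding bernoulli_field_def by (intro prob_space_PiM prob_space_measure_pmf)

lemma prob_space_unit_uniform: "prob_space unit_uniform"
  by (intro prob_space_uniform_measure) auto

lemma prob_space_uniform_field: "prob_space uniform_field"
  by (intro prob_space_PiM prob_space_unit_uniform)

lemma measurable_uniform_field_coordinate: "(\<lambda>u. u v) \<in> borel_measurable uniform_field"
proof -
  have "(\<lambda>u. u v) \<in> uniform_field \<rightarrow>\<^sub>M unit_uniform"
    by (rule measurable_component_singleton) auto
  then show ?thesis
    by (simp cong: measurable_cong_sets)
qed

text \<open>An injective \<open>f\<close> is allowed so that a countable index type can be enumerated by \<open>nat\<close>, which is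
  the form Kolmogorov's 0-1 law needs.\<close>

lemma indep_vars_PiM_coordinates:
  assumes M: "\<And>i. prob_space (M i)" and f: "inj f"
  shows "prob_space.indep_vars (PiM UNIV M) (\<lambda>n. M (f n)) (\<lambda>n x. x (f n)) UNIV"
proof -
  interpret prob_space "PiM UNIV M"
    by (intro prob_space_PiM M)
  have "distr (PiM UNIV M) (PiM UNIV (\<lambda>n. M (f n))) (\<lambda>x. \<lambda>n\<in>UNIV. x (f n))
      = PiM UNIV (\<lambda>n. M (f n))"
    using f by (intro distr_PiM_reindex M) auto
  moreover have "distr (PiM UNIV M) (M (f n)) (\<lambda>x. x (f n)) = M (f n)" for n
    by (intro distr_PiM_component M) auto
  ultimately show ?thesis
    by (subst indep_vars_iff_distr_eq_PiM) auto
qed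

lemma distr_unit_uniform_less:
  assumes "0 \<le> p" "p \<le> 1"
  shows "distr unit_uniform (count_space UNIV) (\<lambda>u. u < p) = measure_pmf (bernoulli_pmf p)"
proof (rule measure_eqI_countable[of _ UNIV])
  have True: "emeasure unit_uniform {u. u < p} = ennreal p"
  proof -
    have "{0..1} \<inter> {u. u < p} = {0..<p}"
      using assms by auto
    then show ?thesis
      using assms by (simp add: divide_ennreal_def)
  qed
  have False: "emeasure unit_uniform {u. \<not> u < p} = ennreal (1 - p)"
  proof -
    have "{0..1} \<inter> {u. \<not> u < p} = {p..1}"
      using assms by auto
    then show ?thesis
      using assms by (simp add: divide_ennreal_def)
  qed
  fix b :: bool
  have "(\<lambda>u. u < p) -` {b} = (if b then {u. u < p} else {u. \<not> u < p})"
    by auto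
  then show "emeasure (distr unit_uniform (count_space UNIV) (\<lambda>u. u < p)) {b} =
      emeasure (measure_pmf (bernoulli_pmf p)) {b}"
    using assms True False
    by (subst emeasure_distr) (auto simp: emeasure_pmf_single)
qed auto

text \<open>The standard coupling: one field of uniform variables, thresholded at \<open>r v\<close>, realises the Bernoulli
  fields for all parameters \<open>r\<close> at once. Monotonicity and measurable dependence on \<open>r\<close> are read off
  from the threshold map.\<close>

lemma bernoulli_field_eq_distr:
  assumes r: "\<And>v. r v \<in> {0..1}"
  shows "bernoulli_field r = distr uniform_field config_space (\<lambda>u v. u v < r v)"
proof -
  interpret prob_space uniform_field
    by (rule prob_space_uniform_field)
  have "indep_vars (\<lambda>_. unit_uniform) (\<lambda>v u. u v) (UNIV :: vertex set)"
    using indep_vars_PiM_coordinates[of "\<lambda>_. unit_uniform" "\<lambda>v::vertex. v"]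
      prob_space_unit_uniform by simp
  then have "indep_vars (\<lambda>_. count_space UNIV) (\<lambda>v. (\<lambda>t. t < r v) \<circ> (\<lambda>u. u v)) UNIV"
    by (rule indep_vars_compose) measurable
  moreover have "distr uniform_field (count_space UNIV) (\<lambda>u. u v < r v) = bernoulli_pmf (r v)" for v
  proof -
    have "distr uniform_field (count_space UNIV) (\<lambda>u. u v < r v) =
        distr (distr uniform_field unit_uniform (\<lambda>u. u v)) (count_space UNIV) (\<lambda>t. t < r v)"
      by (subst distr_distr) (auto simp: comp_def)
    also have "distr uniform_field unit_uniform (\<lambda>u. u v) = unit_uniform"
      by (rule distr_PiM_component) (auto intro: prob_space_unit_uniform)
    finally show ?thesis
      using distr_unit_uniform_less r[of v] by simp
  qed
  ultimately show ?thesis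
    unfolding bernoulli_field_def
    by (subst (asm) indep_vars_iff_distr_eq_PiM) (simp_all add: comp_def restrict_UNIV)
qed

lemma measurable_bernoulli_field:
  assumes [measurable]: "\<And>v. (\<lambda>x. r x v) \<in> borel_measurable N"
    and r: "\<And>x v. r x v \<in> {0..1}"
  shows "(\<lambda>x. bernoulli_field (r x)) \<in> N \<rightarrow>\<^sub>M subprob_algebra config_space"
proof -
  have "(\<lambda>x. distr uniform_field config_space (\<lambda>u v. u v < r x v))
      \<in> N \<rightarrow>\<^sub>M subprob_algebra config_space"
  proof (rule measurable_distr2)
    show "case_prod (\<lambda>x u v. u v < r x v) \<in> N \<Otimes>\<^sub>M uniform_field \<rightarrow>\<^sub>M config_space"
    proof (rule measurable_PiM_single')
      fix v :: vertex
      note [measurable] = measurable_uniform_field_coordinate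
      show "(\<lambda>z. (case z of (x, u) \<Rightarrow> \<lambda>v. u v < r x v) v)
          \<in> N \<Otimes>\<^sub>M uniform_field \<rightarrow>\<^sub>M count_space UNIV"
        unfolding split_beta by measurable
    qed auto
    show "(\<lambda>_. uniform_field) \<in> N \<rightarrow>\<^sub>M subprob_algebra uniform_field"
      by (intro measurable_const)
         (simp add: space_subprob_algebra prob_space_uniform_field prob_space_imp_subprob_space)
  qed
  then show ?thesis
    using bernoulli_field_eq_distr[OF r] by simp
qed

lemma bernoulli_field_mono:
  assumes r: "\<And>v. r v \<in> {0..1}" and s: "\<And>v. s v \<in> {0..1}" and le: "\<And>v. r v \<le> s v"
    and E: "E \<in> sets config_space"
    and incr: "\<And>\<omega> \<omega>'. \<omega> \<in> E \<Longrightarrow> (\<And>v. \<omega> v \<Longrightarrow> \<omega>' v) \<Longrightarrow> \<omega>' \<in> E"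
  shows "emeasure (bernoulli_field r) E \<le> emeasure (bernoulli_field s) E"
proof -
  have meas: "(\<lambda>u v. u v < t v) \<in> uniform_field \<rightarrow>\<^sub>M config_space" for t :: "vertex \<Rightarrow> real"
  proof (rule measurable_PiM_single')
    fix v :: vertex
    note [measurable] = measurable_uniform_field_coordinate
    show "(\<lambda>u. u v < t v) \<in> uniform_field \<rightarrow>\<^sub>M count_space UNIV"
      by measurable
  qed auto
  have "(\<lambda>v. u v < s v) \<in> E" if "(\<lambda>v. u v < r v) \<in> E" for u
    using that by (rule incr) (rule less_le_trans[OF _ le])
  then have "emeasure uniform_field ((\<lambda>u v. u v < r v) -` E \<inter> space uniform_field)
      \<le> emeasure uniform_field ((\<lambda>u v. u v < s v) -` E \<inter> space uniform_field)"
    by (intro emeasure_mono measurable_sets[OF meas E]) auto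
  then show ?thesis
    by (simp add: bernoulli_field_eq_distr[of r, OF r] bernoulli_field_eq_distr[of s, OF s]
        emeasure_distr[OF meas E])
qed

lemma cylinder_in_sets:
  assumes "finite J"
  shows "{\<omega>. \<forall>v\<in>J. \<omega> v \<in> F v} \<in> sets config_space"
proof -
  have "Measurable.pred config_space (\<lambda>\<omega>. \<omega> v \<in> F v)" for v
    by (rule measurable_compose[OF measurable_component_singleton]) auto
  then have "Measurable.pred config_space (\<lambda>\<omega>. \<forall>v\<in>J. \<omega> v \<in> F v)"
    using assms by (intro pred_intros_finite) auto
  from predE[OF this] show ?thesis
    by simp
qed

lemma emeasure_bernoulli_field_cylinder:
  assumes "finite J"
  shows "emeasure (bernoulli_field r) {\<omega>. \<forall>v\<in>J. \<omega> v \<in> F v}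
    = (\<Prod>v\<in>J. emeasure (bernoulli_pmf (r v)) (F v))"
proof -
  interpret product_prob_space "\<lambda>v. measure_pmf (bernoulli_pmf (r v))" UNIV
    by unfold_locales
  have "space (PiM UNIV (\<lambda>v. measure_pmf (bernoulli_pmf (r v)))) = UNIV"
    by (auto simp: space_PiM)
  then show ?thesis
    using emeasure_PiM_Collect[of J F] assms unfolding bernoulli_field_def by simp
qed

lemma emeasure_bernoulli_pmf:
  assumes "p \<in> {0..1}"
  shows "emeasure (bernoulli_pmf p) F = ennreal p * indicator F True + ennreal (1 - p) * indicator F False"
proof -
  have "emeasure (bernoulli_pmf p) F = (\<integral>\<^sup>+b. indicator F b \<partial>bernoulli_pmf p)"
    by simp
  also have "\<dots> = indicator F True * ennreal p + indicator F False * ennreal (1 - p)"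
    using assms by (subst nn_integral_bernoulli_pmf) auto
  finally show ?thesis
    by (simp add: mult.commute)
qed

lemma nn_integral_bernoulli_field_coordinates:
  assumes J: "finite J" and s: "\<And>v. s v \<in> {0..1}"
  shows "(\<integral>\<^sup>+\<omega>. (\<Prod>v\<in>J. f v (\<omega> v)) \<partial>bernoulli_field s)
    = (\<Prod>v\<in>J. f v True * ennreal (s v) + f v False * ennreal (1 - s v))"
proof -
  interpret prob_space "bernoulli_field s"
    by (rule prob_space_bernoulli_field)
  have "indep_vars (\<lambda>v. measure_pmf (bernoulli_pmf (s v))) (\<lambda>v \<omega>. \<omega> v) UNIV"
    using indep_vars_PiM_coordinates[of "\<lambda>v. measure_pmf (bernoulli_pmf (s v))" "\<lambda>v::vertex. v"]
    unfolding bernoulli_field_def by (simp add: prob_space_measure_pmf)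
  then have "indep_vars (\<lambda>v. measure_pmf (bernoulli_pmf (s v))) (\<lambda>v \<omega>. \<omega> v) J"
    by (rule indep_vars_subset) auto
  then have "indep_vars (\<lambda>_. borel) (\<lambda>v. f v \<circ> (\<lambda>\<omega>. \<omega> v)) J"
    by (rule indep_vars_compose) auto
  then have "(\<integral>\<^sup>+\<omega>. (\<Prod>v\<in>J. f v (\<omega> v)) \<partial>bernoulli_field s)
      = (\<Prod>v\<in>J. \<integral>\<^sup>+\<omega>. f v (\<omega> v) \<partial>bernoulli_field s)"
    using J by (subst indep_vars_nn_integral[symmetric]) (auto simp: comp_def)
  also have "\<dots> = (\<Prod>v\<in>J. f v True * ennreal (s v) + f v False * ennreal (1 - s v))"
  proof (rule prod.cong[OF refl])
    fix v
    have "distr (bernoulli_field s) (bernoulli_pmf (s v)) (\<lambda>\<omega>. \<omega> v) = bernoulli_pmf (s v)"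
      unfolding bernoulli_field_def
      by (rule distr_PiM_component) (auto intro: prob_space_measure_pmf)
    moreover have "(\<lambda>\<omega>. \<omega> v) \<in> bernoulli_field s \<rightarrow>\<^sub>M bernoulli_pmf (s v)"
      unfolding bernoulli_field_def by (rule measurable_component_singleton) auto
    ultimately have "(\<integral>\<^sup>+\<omega>. f v (\<omega> v) \<partial>bernoulli_field s) = (\<integral>\<^sup>+b. f v b \<partial>bernoulli_pmf (s v))"
      using nn_integral_distr[of "\<lambda>\<omega>. \<omega> v" "bernoulli_field s" "bernoulli_pmf (s v)" "f v"] by simp
    also have "\<dots> = f v True * ennreal (s v) + f v False * ennreal (1 - s v)"
      using s[of v] by (subst nn_integral_bernoulli_pmf) auto
    finally show "(\<integral>\<^sup>+\<omega>. f v (\<omega> v) \<partial>bernoulli_field s)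
        = f v True * ennreal (s v) + f v False * ennreal (1 - s v)" .
  qed
  finally show ?thesis .
qed

text \<open>Choosing the parameter at each vertex by an independent coin and then sampling gives an
  independent field again, with the mean parameters. On cylinders, integrating over the coins
  factorises vertex by vertex, and cylinders determine a product measure.\<close>

lemma emeasure_bernoulli_field_mixture:
  assumes s: "\<And>v. s v \<in> {0..1}" and a: "\<And>v. a v \<in> {0..1}" and b: "\<And>v. b v \<in> {0..1}"
    and E: "E \<in> sets config_space"
  shows "emeasure (bernoulli_field (\<lambda>v. s v * a v + (1 - s v) * b v)) E
    = (\<integral>\<^sup>+D. emeasure (bernoulli_field (\<lambda>v. if D v then a v else b v)) E \<partial>bernoulli_field s)"
proof -
  let ?m = "\<lambda>v. s v * a v + (1 - s v) * b v"
  let ?K = "\<lambda>D. bernoulli_field (\<lambda>v. if D v then a v else b v)"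
  have m: "?m v \<in> {0..1}" for v
    using s[of v] a[of v] b[of v] convex_bound_le[of "a v" 1 "b v" "s v" "1 - s v"] by auto
  have K: "?K \<in> bernoulli_field s \<rightarrow>\<^sub>M subprob_algebra config_space"
    using a b by (intro measurable_bernoulli_field) auto
  interpret product_prob_space "\<lambda>v. measure_pmf (bernoulli_pmf (?m v))" UNIV
    by unfold_locales
  have "bernoulli_field s \<bind> ?K = bernoulli_field ?m"
    unfolding bernoulli_field_def[of ?m]
  proof (rule PiM_eq)
    have "sets (bernoulli_field s \<bind> ?K) = sets config_space"
      by (rule sets_bind) auto
    also have "\<dots> = sets (PiM UNIV (\<lambda>v. measure_pmf (bernoulli_pmf (?m v))))"
      using sets_bernoulli_field[of ?m] unfolding bernoulli_field_def by simp
    finally show "sets (bernoulli_field s \<bind> ?K) = \<dots>" .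
    fix J :: "vertex set" and F :: "vertex \<Rightarrow> bool set"
    assume J: "finite J"
    let ?cyl = "{\<omega>. \<forall>v\<in>J. \<omega> v \<in> F v}"
    have cyl: "prod_emb UNIV (\<lambda>v. measure_pmf (bernoulli_pmf (?m v))) J (Pi\<^sub>E J F) = ?cyl"
      by (auto simp: prod_emb_def space_PiM)
    have "emeasure (bernoulli_field s \<bind> ?K) ?cyl
        = (\<integral>\<^sup>+D. emeasure (?K D) ?cyl \<partial>bernoulli_field s)"
      using K cylinder_in_sets[OF J] by (intro emeasure_bind[of _ _ config_space]) auto
    also have "\<dots> = (\<integral>\<^sup>+D. (\<Prod>v\<in>J. emeasure (bernoulli_pmf (if D v then a v else b v)) (F v))
        \<partial>bernoulli_field s)"
      by (simp add: emeasure_bernoulli_field_cylinder[OF J])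
    also have "\<dots> = (\<Prod>v\<in>J. emeasure (bernoulli_pmf (a v)) (F v) * ennreal (s v)
        + emeasure (bernoulli_pmf (b v)) (F v) * ennreal (1 - s v))"
      using nn_integral_bernoulli_field_coordinates
        [where f = "\<lambda>v d. emeasure (bernoulli_pmf (if d then a v else b v)) (F v)", OF J s]
      by simp
    also have "\<dots> = (\<Prod>v\<in>J. emeasure (bernoulli_pmf (?m v)) (F v))"
    proof (rule prod.cong[OF refl])
      fix v
      have 1: "1 - ?m v = s v * (1 - a v) + (1 - s v) * (1 - b v)"
        by (simp add: algebra_simps)
      show "emeasure (bernoulli_pmf (a v)) (F v) * ennreal (s v)
          + emeasure (bernoulli_pmf (b v)) (F v) * ennreal (1 - s v)
          = emeasure (bernoulli_pmf (?m v)) (F v)"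
        unfolding emeasure_bernoulli_pmf[OF a] emeasure_bernoulli_pmf[OF b] emeasure_bernoulli_pmf[OF m] 1
        using s[of v] a[of v] b[of v]
        by (simp add: ennreal_mult distrib_left distrib_right ac_simps)
    qed
    finally show "emeasure (bernoulli_field s \<bind> ?K)
        (prod_emb UNIV (\<lambda>v. measure_pmf (bernoulli_pmf (?m v))) J (Pi\<^sub>E J F))
        = (\<Prod>v\<in>J. emeasure (bernoulli_pmf (?m v)) (F v))"
      unfolding cyl .
  qed
  then show ?thesis
    using K E by (subst emeasure_bind[of _ _ config_space, symmetric]) auto
qed

text \<open>Let \<open>S\<close> be the finite set where \<open>r\<close> and \<open>r'\<close> differ. Under \<open>r\<close> the vertices of \<open>S\<close> are all open with
  positive probability, and given this the field dominates the one with parameters \<open>r'\<close>. The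
  conditioning on \<open>S\<close> being open is expressed by the mixture formula: \<open>r\<close> is the mixture, with
  weights \<open>r\<close>, of the parameters \<open>1\<close> and \<open>0\<close> on \<open>S\<close>, and of \<open>r\<close> and \<open>r\<close> off \<open>S\<close>.\<close>

lemma emeasure_bernoulli_field_pos_finite_change:
  assumes r: "\<And>v. r v \<in> {0..1}" and r': "\<And>v. r' v \<in> {0..1}"
    and S: "finite {v. r v \<noteq> r' v}" and pos: "\<And>v. r v \<noteq> r' v \<Longrightarrow> 0 < r v"
    and E: "E \<in> sets config_space"
    and incr: "\<And>\<omega> \<omega>'. \<omega> \<in> E \<Longrightarrow> (\<And>v. \<omega> v \<Longrightarrow> \<omega>' v) \<Longrightarrow> \<omega>' \<in> E"
    and E_pos: "0 < emeasure (bernoulli_field r') E"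
  shows "0 < emeasure (bernoulli_field r) E"
proof -
  let ?S = "{v. r v \<noteq> r' v}"
  let ?a = "\<lambda>v. if v \<in> ?S then 1 else r v" and ?b = "\<lambda>v. if v \<in> ?S then 0 else r v"
  let ?open = "{D. \<forall>v\<in>?S. D v \<in> {True}}"
  have a01: "?a v \<in> {0..1}" and b01: "?b v \<in> {0..1}" for v
    using r[of v] by simp_all
  have "0 < (\<Prod>v\<in>?S. r v)"
    using pos by (intro prod_pos) auto
  moreover have "emeasure (bernoulli_field r) ?open = ennreal (\<Prod>v\<in>?S. r v)"
  proof -
    have "emeasure (bernoulli_field r) ?open = (\<Prod>v\<in>?S. emeasure (bernoulli_pmf (r v)) {True})"
      by (rule emeasure_bernoulli_field_cylinder[OF S])
    also have "\<dots> = (\<Prod>v\<in>?S. ennreal (r v))"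
      by (simp only: emeasure_bernoulli_pmf[OF r]) simp
    also have "\<dots> = ennreal (\<Prod>v\<in>?S. r v)"
      using r by (intro prod_ennreal) auto
    finally show ?thesis .
  qed
  moreover have "emeasure (bernoulli_field r') E \<le> emeasure (bernoulli_field ?a) E"
  proof (rule bernoulli_field_mono)
    show "\<omega>' \<in> E" if "\<omega> \<in> E" "\<And>v. \<omega> v \<Longrightarrow> \<omega>' v" for \<omega> \<omega>'
      using that by (rule incr)
  qed (use r r' E in auto)
  ultimately have "0 < emeasure (bernoulli_field ?a) E * emeasure (bernoulli_field r) ?open"
    using E_pos by (auto simp: ennreal_zero_less_mult_iff)
  also have "\<dots> = (\<integral>\<^sup>+D. emeasure (bernoulli_field ?a) E * indicator ?open D \<partial>bernoulli_field r)"
    by (rule nn_integral_cmult_indicator[symmetric]) (simp only: sets_bernoulli_field cylinder_in_sets[OF S])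
  also have "\<dots> \<le> (\<integral>\<^sup>+D. emeasure (bernoulli_field (\<lambda>v. if D v then ?a v else ?b v)) E
      \<partial>bernoulli_field r)"
  proof (rule nn_integral_mono)
    fix D :: "vertex \<Rightarrow> bool"
    have "(\<lambda>v. if D v then ?a v else ?b v) = ?a" if "D \<in> ?open"
      using that by (auto simp: fun_eq_iff)
    then show "emeasure (bernoulli_field ?a) E * indicator ?open D
        \<le> emeasure (bernoulli_field (\<lambda>v. if D v then ?a v else ?b v)) E"
      by (cases "D \<in> ?open") simp_all
  qed
  also have "\<dots> = emeasure (bernoulli_field (\<lambda>v. r v * ?a v + (1 - r v) * ?b v)) E"
    by (rule emeasure_bernoulli_field_mixture[OF r a01 b01 E, symmetric])
  also have "(\<lambda>v. r v * ?a v + (1 - r v) * ?b v) = r"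
    by (auto simp: fun_eq_iff algebra_simps)
  finally show ?thesis .
qed

text \<open>An event that ignores finite changes is its own preimage under the map that closes the first \<open>n\<close>
  vertices of an enumeration, so it depends only on the remaining ones, for every \<open>n\<close>. Kolmogorov's
  0-1 law applies.\<close>

lemma bernoulli_field_0_1_law:
  assumes E: "E \<in> sets config_space"
    and inv: "\<And>D D'. D \<in> E \<Longrightarrow> finite {v. D v \<noteq> D' v} \<Longrightarrow> D' \<in> E"
  shows "measure (bernoulli_field s) E = 0 \<or> measure (bernoulli_field s) E = 1"
proof -
  interpret prob_space "bernoulli_field s"
    by (rule prob_space_bernoulli_field)
  let ?A = "\<lambda>n. {(\<lambda>D. D (prod_decode n)) -` B \<inter> space (bernoulli_field s) | B. B \<in> (UNIV :: bool set set)}"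
  have "indep_vars (\<lambda>n. measure_pmf (bernoulli_pmf (s (prod_decode n)))) (\<lambda>n D. D (prod_decode n)) UNIV"
    unfolding bernoulli_field_def
    by (intro indep_vars_PiM_coordinates prob_space_measure_pmf inj_prod_decode)
  then have indep: "indep_sets ?A UNIV"
    unfolding indep_vars_def2 by simp
  have vimage: "sets (vimage_algebra (space (bernoulli_field s)) (\<lambda>D. D (prod_decode n)) (count_space UNIV)) = ?A n" for n
    by (subst sets_vimage_algebra2) auto
  have alg: "sigma_algebra (space (bernoulli_field s)) (?A n)" for n
    using sets.sigma_algebra_axioms[of "vimage_algebra (space (bernoulli_field s)) (\<lambda>D. D (prod_decode n)) (count_space UNIV)"]
    unfolding vimage by simp
  have "E \<in> tail_events ?A"
    unfolding tail_events_def
  proof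
    fix n :: nat
    let ?T = "sigma UNIV (\<Union> (?A ` {n..}))"
    define \<rho> where "\<rho> D v = (if prod_encode v \<ge> n then D v else False)" for D :: "vertex \<Rightarrow> bool" and v
    have "\<rho> \<in> ?T \<rightarrow>\<^sub>M config_space"
    proof (rule measurable_PiM_single')
      fix v :: vertex
      show "(\<lambda>D. \<rho> D v) \<in> ?T \<rightarrow>\<^sub>M count_space UNIV"
      proof (cases "prod_encode v \<ge> n")
        case True
        have "(\<lambda>D. \<rho> D v) -` B \<in> sets ?T" for B
        proof -
          have "(\<lambda>D. \<rho> D v) -` B = (\<lambda>D. D (prod_decode (prod_encode v))) -` B \<inter> space (bernoulli_field s)"
            using True by (auto simp: \<rho>_def)
          also have "\<dots> \<in> ?A (prod_encode v)"
            by blast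
          finally have "(\<lambda>D. \<rho> D v) -` B \<in> \<Union> (?A ` {n..})"
            using True by blast
          then show ?thesis
            by (rule in_measure_of[rotated]) auto
        qed
        then show ?thesis
          by (intro measurableI) auto
      next
        case False
        then show ?thesis
          by (simp add: \<rho>_def)
      qed
    qed auto
    then have "\<rho> -` E \<inter> space ?T \<in> sets ?T"
      using E by (rule measurable_sets)
    also have "\<rho> -` E \<inter> space ?T = E"
    proof -
      have fin: "finite {v. D v \<noteq> \<rho> D v}" for D
        by (rule finite_subset[of _ "prod_decode ` {..<n}"])
           (auto simp: \<rho>_def image_iff intro!: bexI[of _ "prod_encode _"] split: if_splits)
      then have "finite {v. \<rho> D v \<noteq> D v}" for D
        using fin[of D] by (simp add: eq_commute)
      with fin show ?thesis
        using inv by (auto simp: space_measure_of_conv)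
    qed
    finally show "E \<in> sigma_sets (space (bernoulli_field s)) (\<Union> (?A ` {n..}))"
      by simp
  qed
  with alg indep show ?thesis
    by (rule kolmogorov_0_1_law)
qed

section \<open>Percolation from the origin\<close>

lemma open_connected_mono:
  "open_connected \<omega> u v \<Longrightarrow> (\<And>w. \<omega> w \<Longrightarrow> \<omega>' w) \<Longrightarrow> open_connected \<omega>' u v"
  unfolding open_connected_def by blast

lemma origin_to_infinity_increasing:
  "\<omega> \<in> origin_to_infinity \<Longrightarrow> (\<And>v. \<omega> v \<Longrightarrow> \<omega>' v) \<Longrightarrow> \<omega>' \<in> origin_to_infinity"
  unfolding origin_to_infinity_def using open_connected_mono[of \<omega> _ _ \<omega>'] by blast

text \<open>Unboundedness of a sequence of reached vertices, in a form that quantifies over countable types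
  only; measurability follows from it.\<close>

lemma origin_to_infinity_iff:
  "\<omega> \<in> origin_to_infinity \<longleftrightarrow> (\<forall>n. \<exists>v. n \<le> fst v + snd v \<and> open_connected \<omega> (0, 0) v)"
proof
  assume "\<omega> \<in> origin_to_infinity"
  then obtain s :: "nat \<Rightarrow> vertex" where unb: "\<not> bounded (range (\<lambda>n. (real (fst (s n)), real (snd (s n)))))"
    and conn: "\<And>n. open_connected \<omega> (0, 0) (s n)"
    unfolding origin_to_infinity_def by blast
  show "\<forall>n. \<exists>v. n \<le> fst v + snd v \<and> open_connected \<omega> (0, 0) v"
  proof (rule ccontr)
    assume "\<not> ?thesis"
    then obtain n where "\<And>k. fst (s k) + snd (s k) < n"
      using conn by (meson not_le)
    then have "norm (real (fst (s k)), real (snd (s k))) \<le> real n" for k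
      using norm_Pair_le[of "real (fst (s k))" "real (snd (s k))"]
      by (smt (verit) of_nat_add of_nat_0_le_iff of_nat_less_iff real_norm_def)
    with unb show False
      by (auto simp: bounded_iff)
  qed
next
  assume "\<forall>n. \<exists>v. n \<le> fst v + snd v \<and> open_connected \<omega> (0, 0) v"
  then obtain s where large: "\<And>n. n \<le> fst (s n) + snd (s n)"
    and conn: "\<And>n. open_connected \<omega> (0, 0) (s n)"
    by metis
  have "\<not> bounded (range (\<lambda>n. (real (fst (s n)), real (snd (s n)))))"
  proof
    assume "bounded (range (\<lambda>n. (real (fst (s n)), real (snd (s n)))))"
    then obtain B where B: "\<And>n. norm (real (fst (s n)), real (snd (s n))) \<le> B"
      by (auto simp: bounded_iff)
    obtain n where n: "2 * B < real n"
      using reals_Archimedean2 by blast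
    have "real n \<le> real (fst (s n)) + real (snd (s n))"
      using large[of n] by linarith
    also have "\<dots> \<le> B + B"
      using norm_fst_le[of "real (fst (s n))" "real (snd (s n))"]
        norm_snd_le[of "real (snd (s n))" "real (fst (s n))"] B[of n] by auto
    finally show False
      using n by simp
  qed
  with conn show "\<omega> \<in> origin_to_infinity"
    unfolding origin_to_infinity_def by blast
qed

lemma origin_to_infinity_in_sets: "origin_to_infinity \<in> sets config_space"
proof -
  have [measurable]: "Measurable.pred config_space (\<lambda>\<omega>. \<omega> v)" for v
    by (rule measurable_component_singleton) auto
  have [measurable]: "Measurable.pred config_space (\<lambda>\<omega>. open_connected \<omega> u v)" for u v
    unfolding open_connected_def by measurable
  have "Measurable.pred config_space (\<lambda>\<omega>. \<forall>n. \<exists>v. n \<le> fst v + snd v \<and> open_connected \<omega> (0, 0) v)"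
    by measurable
  then have "{\<omega> \<in> space config_space. \<forall>n. \<exists>v. n \<le> fst v + snd v \<and> open_connected \<omega> (0, 0) v}
      \<in> sets config_space"
    by (rule predE)
  also have "{\<omega> \<in> space config_space. \<forall>n. \<exists>v. n \<le> fst v + snd v \<and> open_connected \<omega> (0, 0) v}
      = origin_to_infinity"
    by (auto simp: origin_to_infinity_iff)
  finally show ?thesis .
qed

lemma measure_bernoulli_field_pos_iff:
  "0 < measure (bernoulli_field r) E \<longleftrightarrow> 0 < emeasure (bernoulli_field r) E"
proof -
  interpret prob_space "bernoulli_field r"
    by (rule prob_space_bernoulli_field)
  show ?thesis
    by (simp add: emeasure_eq_measure)
qed

section \<open>Dilution\<close>

text \<open>The theorem for one fixed environment \<open>A\<close>: if the process averaged over the dilution percolates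
  with positive probability, then so does the quenched one for almost every dilution. The condition
  \<open>q > 0\<close> is what makes positivity insensitive to finite changes of the dilution.\<close>

lemma AE_diluted_percolation_pos:
  assumes \<phi>: "\<phi> \<in> {0..1}" and p: "p \<in> {0<..1}" and q: "q \<in> {0<..1}"
    and pos: "0 < measure (percolation A (\<phi> * p + (1 - \<phi>) * q) q) origin_to_infinity"
  shows "AE D in dilution_law \<phi>. 0 < measure (percolation (diluted A D) p q) origin_to_infinity"
proof -
  let ?a = "\<lambda>v. if v \<in> A then p else q"
  let ?r = "\<lambda>D v. if D v then ?a v else q"
  let ?P = "\<lambda>D. emeasure (bernoulli_field (?r D)) origin_to_infinity"
  let ?E = "{D. 0 < ?P D}"
  have perc: "percolation (diluted A D) p q = bernoulli_field (?r D)" for D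
    unfolding percolation_def diluted_def by (intro arg_cong[of _ _ bernoulli_field]) auto
  interpret prob_space "dilution_law \<phi>"
    unfolding dilution_law_def by (rule prob_space_bernoulli_field)
  have r: "?r D v \<in> {0..1}" for D v
    using p q by auto
  have K: "(\<lambda>D. bernoulli_field (?r D)) \<in> config_space \<rightarrow>\<^sub>M subprob_algebra config_space"
    using p q by (intro measurable_bernoulli_field) auto
  have P: "?P \<in> borel_measurable config_space"
    using measurable_compose[OF K measurable_emeasure_subprob_algebra[OF origin_to_infinity_in_sets]] .
  have E: "?E \<in> sets config_space"
    using measurable_sets[OF P, of "{0<..}"] by (simp add: vimage_def)
  have "measure (dilution_law \<phi>) ?E \<noteq> 0"
  proof
    assume "measure (dilution_law \<phi>) ?E = 0"
    then have "AE D in dilution_law \<phi>. \<not> 0 < ?P D"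
      using E prob_eq_0[of ?E] by (simp add: dilution_law_def)
    then have "(\<integral>\<^sup>+D. ?P D \<partial>dilution_law \<phi>) = (\<integral>\<^sup>+D. 0 \<partial>dilution_law \<phi>)"
      by (intro nn_integral_cong_AE) (auto elim!: eventually_mono)
    moreover have "(\<integral>\<^sup>+D. ?P D \<partial>dilution_law \<phi>)
        = emeasure (bernoulli_field (\<lambda>v. \<phi> * ?a v + (1 - \<phi>) * q)) origin_to_infinity"
      unfolding dilution_law_def using \<phi> p q
      by (intro emeasure_bernoulli_field_mixture[symmetric] origin_to_infinity_in_sets) auto
    moreover have "bernoulli_field (\<lambda>v. \<phi> * ?a v + (1 - \<phi>) * q)
        = percolation A (\<phi> * p + (1 - \<phi>) * q) q"
      unfolding percolation_def by (intro arg_cong[of _ _ bernoulli_field]) (auto simp: algebra_simps)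
    ultimately have "emeasure (percolation A (\<phi> * p + (1 - \<phi>) * q) q) origin_to_infinity = 0"
      by simp
    with pos show False
      by (simp add: measure_def)
  qed
  moreover have "D' \<in> ?E" if "D \<in> ?E" "finite {v. D v \<noteq> D' v}" for D D'
  proof -
    have fin: "finite {v. ?r D' v \<noteq> ?r D v}"
      using that(2) by (rule rev_finite_subset) auto
    show ?thesis
      unfolding mem_Collect_eq
    proof (rule emeasure_bernoulli_field_pos_finite_change[where r = "?r D'" and r' = "?r D"])
      show "\<omega>' \<in> origin_to_infinity"
        if "\<omega> \<in> origin_to_infinity" "\<And>v. \<omega> v \<Longrightarrow> \<omega>' v" for \<omega> \<omega>'
        using that by (rule origin_to_infinity_increasing)
    qed (use r fin that(1) p q origin_to_infinity_in_sets in auto)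
  qed
  ultimately have "prob ?E = 1"
    using bernoulli_field_0_1_law[OF E, of "\<lambda>_. \<phi>"] unfolding dilution_law_def by blast
  then have "AE D in dilution_law \<phi>. D \<in> ?E"
    by (rule AE_prob_1)
  then show ?thesis
    by (simp add: perc measure_bernoulli_field_pos_iff)
qed

section \<open>Random environments\<close>

lemma space_nat_set_space [simp]: "space nat_set_space = UNIV"
  by (simp add: nat_set_space_def space_measure_of_conv)

lemma measurable_nat_set_mem: "Measurable.pred nat_set_space (\<lambda>S. n \<in> S)"
proof -
  have "{S. n \<in> S} \<in> sets nat_set_space"
    unfolding nat_set_space_def by (subst sets_measure_of) auto
  then show ?thesis
    by (simp add: pred_def)
qed

text \<open>\<open>lines_law\<close> is a push-forward along \<open>selected_lines\<close>, so this map has to be measurable for the law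
  to be a probability measure.\<close>

lemma measurable_selected_lines:
  assumes \<xi>: "\<And>k. k \<ge> 1 \<Longrightarrow> \<xi> k \<in> M \<rightarrow>\<^sub>M count_space UNIV"
  shows "selected_lines \<xi> \<in> M \<rightarrow>\<^sub>M nat_set_space"
  unfolding nat_set_space_def
proof (rule measurable_measure_of)
  fix X :: "nat set set"
  assume "X \<in> range (\<lambda>n. {S. n \<in> S})"
  then obtain n where X: "X = {S. n \<in> S}"
    by auto
  have sum: "(\<lambda>a. \<Sum>k=1..m. \<xi> k a) \<in> M \<rightarrow>\<^sub>M count_space UNIV" for m
  proof (induction m)
    case (Suc m)
    note [measurable] = Suc \<xi>[of "Suc m"]
    have "(\<lambda>a. (\<Sum>k=1..m. \<xi> k a) + \<xi> (Suc m) a) \<in> M \<rightarrow>\<^sub>M count_space UNIV"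
      by measurable
    then show ?case
      by simp
  qed simp
  note [measurable] = sum
  have "{a \<in> space M. n = 0 \<or> (\<exists>m\<ge>1. n = (\<Sum>k=1..m. \<xi> k a))} \<in> sets M"
    by measurable
  also have "{a \<in> space M. n = 0 \<or> (\<exists>m\<ge>1. n = (\<Sum>k=1..m. \<xi> k a))}
      = selected_lines \<xi> -` X \<inter> space M"
    by (auto simp: X selected_lines_def)
  finally show "selected_lines \<xi> -` X \<inter> space M \<in> sets M" .
qed auto

lemma prob_space_lines_law:
  assumes "prob_space M" "iid_spacings M \<xi>"
  shows "prob_space (lines_law M \<xi>)"
proof -
  interpret prob_space M by fact
  have "\<xi> k \<in> M \<rightarrow>\<^sub>M count_space UNIV" if "k \<ge> 1" for k
    using assms(2) that unfolding iid_spacings_def indep_vars_def2 by auto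
  then show ?thesis
    unfolding lines_law_def by (intro prob_space_distr measurable_selected_lines)
qed

theorem theorem1:
  fixes M :: "'a measure" and \<xi>x \<xi>y :: "nat \<Rightarrow> 'a \<Rightarrow> nat"
  assumes "prob_space M"
    and "iid_spacings M \<xi>x"
    and "iid_spacings M \<xi>y"
    and "independent_spacings M \<xi>x \<xi>y"
    and "\<forall>\<epsilon>\<in>{0<..1 - p_c}. \<exists>\<delta>\<in>{0<..p_c}.
           AE (C, R) in environment_law M \<xi>x \<xi>y.
             measure (percolation (C \<times> R) (p_c + \<epsilon>) (p_c - \<delta>)) origin_to_infinity > 0"
  shows "\<forall>\<phi>\<in>{0<..1}. \<forall>\<epsilon>'\<in>{0<..1 - p_c}. \<exists>\<delta>'\<in>{0<..p_c}.
           AE ((C, R), D) in environment_law M \<xi>x \<xi>y \<Otimes>\<^sub>M dilution_law \<phi>.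
             measure (percolation (diluted (C \<times> R) D) (p_c + \<epsilon>') (p_c - \<delta>')) origin_to_infinity > 0"
proof (intro ballI)
  fix \<phi> \<epsilon>' :: real
  assume \<phi>: "\<phi> \<in> {0<..1}" and \<epsilon>': "\<epsilon>' \<in> {0<..1 - p_c}"
  define \<epsilon> where "\<epsilon> = \<phi> * \<epsilon>' / 2"
  have "\<phi> * \<epsilon>' \<le> 1 * \<epsilon>'"
    using \<phi> \<epsilon>' by (intro mult_right_mono) auto
  moreover have "0 < \<phi> * \<epsilon>'"
    using \<phi> \<epsilon>' by simp
  ultimately have \<epsilon>: "\<epsilon> \<in> {0<..1 - p_c}"
    using \<epsilon>' unfolding \<epsilon>_def greaterThanAtMost_iff by linarith
  with assms(5) obtain \<delta> where \<delta>: "\<delta> \<in> {0<..p_c}"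
    and AE_env: "AE (C, R) in environment_law M \<xi>x \<xi>y.
      measure (percolation (C \<times> R) (p_c + \<epsilon>) (p_c - \<delta>)) origin_to_infinity > 0"
    by blast
  \<comment> \<open>\<open>\<delta>' \<le> \<delta>\<close> allows the use of the hypothesis, \<open>\<delta>' \<le> \<epsilon>\<close> keeps the mean above \<open>p_c + \<epsilon>\<close>, and the
    bound by \<open>p_c / 2\<close> keeps \<open>p_c - \<delta>'\<close> positive.\<close>
  define \<delta>' where "\<delta>' = min (min \<delta> \<epsilon>) (p_c / 2)"
  have \<delta>': "0 < \<delta>'" "\<delta>' \<le> \<delta>" "\<delta>' \<le> \<epsilon>" "\<delta>' < p_c"
    using \<epsilon> \<delta> by (auto simp: \<delta>'_def)
  let ?p = "p_c + \<epsilon>'" and ?q = "p_c - \<delta>'"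
  let ?mean = "\<phi> * ?p + (1 - \<phi>) * ?q"
  have "(1 - \<phi>) * \<delta>' \<le> 1 * \<epsilon>"
    using \<phi> \<delta>' by (intro mult_mono) auto
  then have mean_ge: "p_c + \<epsilon> \<le> ?mean"
    by (simp add: \<epsilon>_def algebra_simps)
  have pq: "?p \<in> {0<..1}" "?q \<in> {0<..1}"
    using \<epsilon>' \<delta>' \<epsilon> by auto
  have mean: "?mean \<in> {0..1}"
    using \<phi> pq convex_bound_le[of ?p 1 ?q \<phi> "1 - \<phi>"] by auto

  interpret X: prob_space "lines_law M \<xi>x"
    using assms by (intro prob_space_lines_law)
  interpret Y: prob_space "lines_law M \<xi>y"
    using assms by (intro prob_space_lines_law)
  interpret XY: pair_prob_space "lines_law M \<xi>x" "lines_law M \<xi>y" ..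
  interpret D: prob_space "dilution_law \<phi>"
    unfolding dilution_law_def by (rule prob_space_bernoulli_field)
  interpret Env: pair_prob_space "environment_law M \<xi>x \<xi>y" "dilution_law \<phi>"
    unfolding environment_law_def ..

  have "AE CR in environment_law M \<xi>x \<xi>y. AE D in dilution_law \<phi>.
      0 < measure (percolation (diluted (fst CR \<times> snd CR) D) ?p ?q) origin_to_infinity"
    using AE_env
  proof (rule eventually_mono)
    fix CR :: "nat set \<times> nat set"
    assume "case CR of (C, R) \<Rightarrow>
      0 < measure (percolation (C \<times> R) (p_c + \<epsilon>) (p_c - \<delta>)) origin_to_infinity"
    then have "0 < emeasure (percolation (fst CR \<times> snd CR) (p_c + \<epsilon>) (p_c - \<delta>)) origin_to_infinity"
      by (simp add: split_beta percolation_def measure_bernoulli_field_pos_iff)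
    also have "\<dots> \<le> emeasure (percolation (fst CR \<times> snd CR) ?mean ?q) origin_to_infinity"
      unfolding percolation_def
    proof (rule bernoulli_field_mono)
      show "\<omega>' \<in> origin_to_infinity"
        if "\<omega> \<in> origin_to_infinity" "\<And>v. \<omega> v \<Longrightarrow> \<omega>' v" for \<omega> \<omega>'
        using that by (rule origin_to_infinity_increasing)
    qed (use origin_to_infinity_in_sets mean pq mean_ge \<epsilon> \<delta> \<delta>' in auto)
    finally show "AE D in dilution_law \<phi>.
        0 < measure (percolation (diluted (fst CR \<times> snd CR) D) ?p ?q) origin_to_infinity"
      using \<phi> pq by (intro AE_diluted_percolation_pos)
        (auto simp: percolation_def measure_bernoulli_field_pos_iff)
  qed
  moreover have "{z \<in> space (environment_law M \<xi>x \<xi>y \<Otimes>\<^sub>M dilution_law \<phi>).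
      0 < measure (percolation (diluted (fst (fst z) \<times> snd (fst z)) (snd z)) ?p ?q) origin_to_infinity}
      \<in> sets (environment_law M \<xi>x \<xi>y \<Otimes>\<^sub>M dilution_law \<phi>)"
  proof -
    let ?N = "environment_law M \<xi>x \<xi>y \<Otimes>\<^sub>M dilution_law \<phi>"
    have [measurable]: "Measurable.pred (lines_law M \<xi>) (\<lambda>S. n \<in> S)" for \<xi> :: "nat \<Rightarrow> 'a \<Rightarrow> nat" and n
      using measurable_nat_set_mem[of n] unfolding lines_law_def by simp
    have [measurable]: "Measurable.pred (dilution_law \<phi>) (\<lambda>D. D v)" for v
      unfolding dilution_law_def bernoulli_field_def by measurable
    have "Measurable.pred ?N (\<lambda>z. v \<in> diluted (fst (fst z) \<times> snd (fst z)) (snd z))" for v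
      unfolding diluted_def mem_Collect_eq mem_Times_iff environment_law_def by measurable
    then have "(\<lambda>z. percolation (diluted (fst (fst z) \<times> snd (fst z)) (snd z)) ?p ?q)
        \<in> ?N \<rightarrow>\<^sub>M subprob_algebra config_space"
      unfolding percolation_def using pq
      by (intro measurable_bernoulli_field) auto
    from measurable_compose[OF this measurable_measure_subprob_algebra[OF origin_to_infinity_in_sets]]
    show ?thesis
      by measurable
  qed
  ultimately have "AE ((C, R), D) in environment_law M \<xi>x \<xi>y \<Otimes>\<^sub>M dilution_law \<phi>.
      0 < measure (percolation (diluted (C \<times> R) D) ?p ?q) origin_to_infinity"
    using Env.AE_pair_measure[where P = "\<lambda>z. 0 < measure (percolation
      (diluted (fst (fst z) \<times> snd (fst z)) (snd z)) ?p ?q) origin_to_infinity"]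
    by (simp add: split_beta)
  then show "\<exists>\<delta>'\<in>{0<..p_c}. AE ((C, R), D) in environment_law M \<xi>x \<xi>y \<Otimes>\<^sub>M dilution_law \<phi>.
      0 < measure (percolation (diluted (C \<times> R) D) (p_c + \<epsilon>') (p_c - \<delta>')) origin_to_infinity"
    using \<delta>' by (intro bexI[of _ \<delta>']) auto
qed

end
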